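(* Let $G$ be a finite-by-abelian-by-finite group. Then: (i) $G$ is a CN-group if and only if $G$ is finite-by-CF, i.e. $G$ has a finite normal subgroup $F$ such that $G/F$ is a CF-group. (ii) $G$ is a BCN-group if and only if $G$ is finite-by-BCF, i.e. $G$ has a finite normal subgroup $F$ such that $G/F$ is a BCF-group.
   Context: For a subgroup $H$ of a group $G$, let $\delta_G(H)$ be the minimum of the indices $|HN:(H\cap N)|$ as $N$ ranges over the normal subgroups of $G$. $G$ is a CN-group if $\delta_G(H)$ is finite for all $H\le G$ (equivalently, every subgroup $H$ of $G$ is commensurable with a normal subgroup $N$ of $G$, i.e. $H\cap N$ has finite index in both $H$ and $N$). $G$ is a BCN-group if there is $n\in\mathbb{N}$ such that $\delta_G(H)\le n$ for all $H\le G$. For $H\le G$, $H_G=\bigcap_{g\in G}H^g$ denotes the normal core of $H$ in $G$. $G$ is a CF-group if $|H:H_G|$ is finite for all $H\le G$; $G$ is a BCF-group if there is $n\in\mathbb{N}$ such that $|H:H_G|\le n$ for all $H\le G$. A group is finite-by-abelian if its derived subgroup is finite, and finite-by-abelian-by-finite if it has a finite-by-abelian subgroup of finite index. *)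

theory Defs
  imports "HOL-Algebra.Algebra" "HOL-Library.Extended_Nat"
begin

text \<open>
  The index \<open>|H : K|\<close> takes values in \<^typ>\<open>enat\<close>, because the cardinality of an infinite set of
  cosets would be \<open>0\<close>. It is meaningful for subgroups \<open>K \<subseteq> H\<close> of \<open>G\<close>.
\<close>

definition subgroup_index :: "('a, 'b) monoid_scheme \<Rightarrow> 'a set \<Rightarrow> 'a set \<Rightarrow> enat" where
  "subgroup_index G H K =
     (let C = rcosets\<^bsub>G\<lparr>carrier := H\<rparr>\<^esub> K in if finite C then enat (card C) else \<infinity>)"

definition delta :: "('a, 'b) monoid_scheme \<Rightarrow> 'a set \<Rightarrow> enat" where
  "delta G H = (INF N \<in> {N. N \<lhd> G}. subgroup_index G (H <#>\<^bsub>G\<^esub> N) (H \<inter> N))"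

text \<open>The infimum is a minimum:\<close>

lemma delta_attained:
  assumes "group G"
  shows "\<exists>N. N \<lhd> G \<and> delta G H = subgroup_index G (H <#>\<^bsub>G\<^esub> N) (H \<inter> N)"
proof -
  let ?S = "(\<lambda>N. subgroup_index G (H <#>\<^bsub>G\<^esub> N) (H \<inter> N)) ` {N. N \<lhd> G}"
  have "{\<one>\<^bsub>G\<^esub>} \<lhd> G"
    using assms by (rule group.one_is_normal)
  hence "?S \<noteq> {}" by blast
  hence "Inf ?S \<in> ?S" by (auto simp: Inf_enat_def intro: LeastI)
  thus ?thesis by (auto simp: delta_def)
qed

definition CN_group :: "('a, 'b) monoid_scheme \<Rightarrow> bool" where
  "CN_group G \<longleftrightarrow> (\<forall>H. subgroup H G \<longrightarrow> delta G H \<noteq> \<infinity>)"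

definition BCN_group :: "('a, 'b) monoid_scheme \<Rightarrow> bool" where
  "BCN_group G \<longleftrightarrow> (\<exists>n::nat. \<forall>H. subgroup H G \<longrightarrow> delta G H \<le> enat n)"

definition normal_core :: "('a, 'b) monoid_scheme \<Rightarrow> 'a set \<Rightarrow> 'a set" where
  "normal_core G H = (\<Inter>g \<in> carrier G. (inv\<^bsub>G\<^esub> g <#\<^bsub>G\<^esub> H) #>\<^bsub>G\<^esub> g)"

definition CF_group :: "('a, 'b) monoid_scheme \<Rightarrow> bool" where
  "CF_group G \<longleftrightarrow> (\<forall>H. subgroup H G \<longrightarrow> subgroup_index G H (normal_core G H) \<noteq> \<infinity>)"

definition BCF_group :: "('a, 'b) monoid_scheme \<Rightarrow> bool" where
  "BCF_group G \<longleftrightarrow>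
     (\<exists>n::nat. \<forall>H. subgroup H G \<longrightarrow> subgroup_index G H (normal_core G H) \<le> enat n)"

definition finite_by_abelian :: "('a, 'b) monoid_scheme \<Rightarrow> bool" where
  "finite_by_abelian G \<longleftrightarrow> finite (derived G (carrier G))"

definition finite_by_abelian_by_finite :: "('a, 'b) monoid_scheme \<Rightarrow> bool" where
  "finite_by_abelian_by_finite G \<longleftrightarrow>
     (\<exists>K. subgroup K G \<and> subgroup_index G (carrier G) K \<noteq> \<infinity> \<and>
          finite_by_abelian (G\<lparr>carrier := K\<rparr>))"

end

theory Submission
  imports Defs
begin

text \<open>
  The point of the theorem is that, above a finite normal subgroup, only finitely many
  conjugates of a subgroup matter. Let \<open>K\<close> have finite index in \<open>G\<close> and finite derived
  subgroup. Its normal core \<open>L\<close> still has finite index \<open>m\<close>, and \<open>F = L'\<close> is a finite normal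
  subgroup of \<open>G\<close>.

  Suppose that subgroups of \<open>G\<close> are commensurable with normal subgroups. A subgroup of \<open>G/F\<close> is
  the image of some \<open>H \<ge> F\<close>. As \<open>L/F\<close> is abelian, \<open>B = H \<inter> L\<close> is normalised by \<open>L\<close>, so
  it has at most \<open>m\<close> conjugates in \<open>G\<close>. If \<open>N\<close> is normal in \<open>G\<close> with \<open>|BN : B \<inter> N| \<le> n\<close>, then
  \<open>|N : B\<^sup>g \<inter> N| = |N : B \<inter> N| \<le> n\<close> for every \<open>g\<close>, hence the intersection \<open>C\<close> of \<open>N\<close> with all
  conjugates of \<open>B\<close> has index at most \<open>n^m\<close> in \<open>N\<close>. From \<open>|H : B| \<le> m\<close>,
  \<open>|B : B \<inter> N| \<le> n\<close> and \<open>C \<subseteq> B \<inter> N\<close>, the core of \<open>H\<close>, which contains \<open>C\<close>, has index at most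
  \<open>m n n^m\<close> in \<open>H\<close>. This is lemma \<open>core_index_le_if_delta_le\<close>, which rests on
  \<open>normal_core_index_le\<close>.

  Conversely, let \<open>F\<close> be a finite normal subgroup and let \<open>N\<close> be the preimage in \<open>G\<close> of the core of
  \<open>HF/F\<close>. Then \<open>HN \<le> HF\<close> and \<open>|HF : H \<inter> N| \<le> |HF : H| |HF : N| \<le> |F| |HF : N|\<close>, so \<open>H\<close> is
  commensurable with \<open>N\<close>: lemma \<open>delta_le_if_core_index_le\<close>.

  Both estimates give for each subgroup an explicit bound on one invariant in terms of the other,
  and the constants \<open>m\<close> and \<open>|F|\<close> depend on \<open>G\<close> alone. The bounded and the unbounded equivalence
  therefore follow together.
\<close>

section \<open>Bounds on the index\<close>

lemma not_infinity_iff_le: "x \<noteq> \<infinity> \<longleftrightarrow> (\<exists>n. x \<le> enat n)"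
  by (cases x) auto

lemma rcosets_restrict: "rcosets\<^bsub>G\<lparr>carrier := H\<rparr>\<^esub> K = (\<lambda>x. K #>\<^bsub>G\<^esub> x) ` H"
  by (auto simp: RCOSETS_def r_coset_def)

lemma subgroup_index_le_iff:
  "subgroup_index G H K \<le> enat n \<longleftrightarrow>
     finite ((\<lambda>x. K #>\<^bsub>G\<^esub> x) ` H) \<and> card ((\<lambda>x. K #>\<^bsub>G\<^esub> x) ` H) \<le> n"
  by (simp add: subgroup_index_def rcosets_restrict Let_def)

lemma delta_le_iff:
  assumes "group G"
  shows "delta G H \<le> enat n \<longleftrightarrow>
    (\<exists>N. N \<lhd> G \<and> subgroup_index G (H <#>\<^bsub>G\<^esub> N) (H \<inter> N) \<le> enat n)"
proof
  assume "delta G H \<le> enat n"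
  with delta_attained[OF assms, of H]
  show "\<exists>N. N \<lhd> G \<and> subgroup_index G (H <#>\<^bsub>G\<^esub> N) (H \<inter> N) \<le> enat n"
    by auto
next
  assume "\<exists>N. N \<lhd> G \<and> subgroup_index G (H <#>\<^bsub>G\<^esub> N) (H \<inter> N) \<le> enat n"
  then obtain N where "N \<in> {N. N \<lhd> G}" "subgroup_index G (H <#>\<^bsub>G\<^esub> N) (H \<inter> N) \<le> enat n"
    by blast
  then show "delta G H \<le> enat n"
    unfolding delta_def by (rule INF_lower2)
qed

context group
begin

text \<open>
  Index bounds are handled through colourings: \<open>|H : K| \<le> n\<close> iff the elements of \<open>H\<close> can be
  coloured with \<open>n\<close> colours so that elements of the same colour lie in the same coset of \<open>K\<close>. The
  colour classes may be finer than the cosets, so a bound for an intersection comes from pairing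
  or tupling colourings, without any description of the cosets of the intersection.
\<close>

lemma index_leI:
  assumes K: "subgroup K G" and H: "H \<subseteq> carrier G"
    and C: "finite C" "f ` H \<subseteq> C"
    and f: "\<And>x y. \<lbrakk>x \<in> H; y \<in> H; f x = f y\<rbrakk> \<Longrightarrow> x \<otimes> inv y \<in> K"
  shows "subgroup_index G H K \<le> enat (card C)"
proof -
  let ?g = "\<lambda>c. K #> (SOME y. y \<in> H \<and> f y = c)"
  have Kc: "K \<subseteq> carrier G"
    by (rule subgroup.subset[OF K])
  have eq: "(\<lambda>x. K #> x) ` H = ?g ` f ` H"
    unfolding image_image
  proof (rule image_cong[OF refl])
    fix x assume x: "x \<in> H"
    let ?y = "SOME y. y \<in> H \<and> f y = f x"
    have y: "?y \<in> H \<and> f ?y = f x"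
      by (rule someI[of _ x]) (use x in simp)
    have in_K: "x \<otimes> inv ?y \<in> K"
      by (rule f[OF x conjunct1[OF y] conjunct2[OF y, symmetric]])
    have "K #> (x \<otimes> inv ?y) = K"
      by (rule coset_join2[OF subgroup.mem_carrier[OF K in_K] K in_K])
    then show "K #> x = K #> ?y"
      by (rule coset_mult_inv1) (use x y H Kc in blast)+
  qed
  have fin: "finite (f ` H)"
    using C finite_subset by blast
  have "card (?g ` f ` H) \<le> card (f ` H)"
    by (rule card_image_le[OF fin])
  also have "\<dots> \<le> card C"
    using C by (simp add: card_mono)
  finally show ?thesis
    unfolding subgroup_index_le_iff eq using fin by simp
qed

lemma index_leE:
  assumes le: "subgroup_index G H K \<le> enat n"
    and K: "subgroup K G" and H: "H \<subseteq> carrier G"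
  obtains f :: "'a \<Rightarrow> nat" where "f ` H \<subseteq> {..<n}"
    and "\<And>x y. \<lbrakk>x \<in> H; y \<in> H; f x = f y\<rbrakk> \<Longrightarrow> x \<otimes> inv y \<in> K"
proof -
  let ?C = "(\<lambda>x. K #> x) ` H"
  from le have fin: "finite ?C" and card: "card ?C \<le> n"
    by (auto simp: subgroup_index_le_iff)
  obtain e where e: "bij_betw e ?C {0..<card ?C}"
    using ex_bij_betw_finite_nat[OF fin] by blast
  show thesis
  proof (rule that[of "\<lambda>x. e (K #> x)"])
    show "(\<lambda>x. e (K #> x)) ` H \<subseteq> {..<n}"
    proof
      fix i assume "i \<in> (\<lambda>x. e (K #> x)) ` H"
      then have "i \<in> {0..<card ?C}"
        using bij_betwE[OF e] by blast
      then show "i \<in> {..<n}"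
        using card by simp
    qed
  next
    fix x y assume xy: "x \<in> H" "y \<in> H" and "e (K #> x) = e (K #> y)"
    then have "K #> x = K #> y"
      using inj_onD[OF bij_betw_imp_inj_on[OF e]] by blast
    then have "x \<in> K #> y"
      using rcos_self[OF _ K, of x] xy H by blast
    then show "x \<otimes> inv y \<in> K"
      using subgroup.rcos_module_imp[OF K is_group] xy H by blast
  qed
qed

text \<open>
  The smaller group \<open>H'\<close> inherits the colouring of \<open>H\<close>; that \<open>K'\<close> need only contain \<open>K \<inter> H'\<close>
  covers both enlarging the lower group and intersecting both groups with a third one.
\<close>

lemma index_mono:
  assumes "subgroup_index G H K \<le> enat n" "subgroup K G" "H \<subseteq> carrier G"
    and "H' \<subseteq> H" "subgroup K' G" "K \<inter> H' \<subseteq> K'" "subgroup H' G"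
  shows "subgroup_index G H' K' \<le> enat n"
proof -
  obtain f :: "'a \<Rightarrow> nat" where f: "f ` H \<subseteq> {..<n}"
    and *: "\<And>x y. \<lbrakk>x \<in> H; y \<in> H; f x = f y\<rbrakk> \<Longrightarrow> x \<otimes> inv y \<in> K"
    using index_leE[OF assms(1-3)] by blast
  have "subgroup_index G H' K' \<le> enat (card {..<n})"
  proof (rule index_leI)
    fix x y assume "x \<in> H'" "y \<in> H'" "f x = f y"
    then show "x \<otimes> inv y \<in> K'"
      using * assms(4,6,7) by (meson IntI subgroup_def subsetD)
  next
    show "f ` H' \<subseteq> {..<n}"
      using f assms(4) by blast
  qed (use assms in auto)
  then show ?thesis by simp
qed

lemma index_trans:
  assumes HM: "subgroup_index G H M \<le> enat m" and MK: "subgroup_index G M K \<le> enat n"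
    and sub: "subgroup H G" "subgroup M G" "subgroup K G"
  shows "subgroup_index G H K \<le> enat (m * n)"
proof -
  have sets: "H \<subseteq> carrier G" "M \<subseteq> carrier G"
    using sub by (auto dest: subgroup.subset)
  obtain f :: "'a \<Rightarrow> nat" where f: "f ` H \<subseteq> {..<m}"
    and fM: "\<And>x y. \<lbrakk>x \<in> H; y \<in> H; f x = f y\<rbrakk> \<Longrightarrow> x \<otimes> inv y \<in> M"
    using index_leE[OF HM sub(2) sets(1)] by blast
  obtain g :: "'a \<Rightarrow> nat" where g: "g ` M \<subseteq> {..<n}"
    and gK: "\<And>x y. \<lbrakk>x \<in> M; y \<in> M; g x = g y\<rbrakk> \<Longrightarrow> x \<otimes> inv y \<in> K"
    using index_leE[OF MK sub(3) sets(2)] by blast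
  \<comment> \<open>Each colour class of \<open>f\<close> gets a representative \<open>r\<close>; the quotient \<open>x \<otimes> inv (r x)\<close> lies in \<open>M\<close>,
    where the second colouring separates elements up to \<open>K\<close>.\<close>
  define r where "r x = (SOME y. y \<in> H \<and> f y = f x)" for x
  have r: "r x \<in> H" "f (r x) = f x" if "x \<in> H" for x
    using someI[of "\<lambda>y. y \<in> H \<and> f y = f x" x] that by (auto simp: r_def)
  have rM: "x \<otimes> inv (r x) \<in> M" if "x \<in> H" for x
    using fM r that by simp
  have "subgroup_index G H K \<le> enat (card ({..<m} \<times> {..<n}))"
  proof (rule index_leI)
    show "(\<lambda>x. (f x, g (x \<otimes> inv (r x)))) ` H \<subseteq> {..<m} \<times> {..<n}"
      using f g rM by auto
  next
    fix x y assume xy: "x \<in> H" "y \<in> H"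
      and eq: "(f x, g (x \<otimes> inv (r x))) = (f y, g (y \<otimes> inv (r y)))"
    then have "r x = r y"
      by (simp add: r_def)
    moreover have c: "x \<in> carrier G" "y \<in> carrier G" "r y \<in> carrier G"
      using xy r sets by auto
    ultimately have "x \<otimes> inv (r x) \<otimes> inv (y \<otimes> inv (r y)) = x \<otimes> inv y"
      by (simp add: inv_mult_group m_assoc flip: m_assoc[of "inv (r y)" "r y"])
    then show "x \<otimes> inv y \<in> K"
      using gK[OF rM rM] xy eq by (metis Pair_inject)
  qed (use sub sets in auto)
  then show ?thesis by simp
qed

section \<open>Normal cores\<close>

lemma normal_core_iff:
  assumes "H \<subseteq> carrier G"
  shows "x \<in> normal_core G H \<longleftrightarrow> x \<in> carrier G \<and> (\<forall>g \<in> carrier G. g \<otimes> x \<otimes> inv g \<in> H)"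
proof -
  have "x \<in> (inv g <# H) #> g \<longleftrightarrow> x \<in> carrier G \<and> g \<otimes> x \<otimes> inv g \<in> H"
    if g: "g \<in> carrier G" for g
  proof
    assume "x \<in> (inv g <# H) #> g"
    then obtain h where "h \<in> H" "x = inv g \<otimes> h \<otimes> g"
      by (auto simp: l_coset_def r_coset_def)
    moreover then have "g \<otimes> x \<otimes> inv g = h"
      using g assms by (simp add: m_assoc subset_iff flip: m_assoc[of g "inv g"])
    ultimately show "x \<in> carrier G \<and> g \<otimes> x \<otimes> inv g \<in> H"
      using g assms by auto
  next
    assume x: "x \<in> carrier G \<and> g \<otimes> x \<otimes> inv g \<in> H"
    then have "x = inv g \<otimes> (g \<otimes> x \<otimes> inv g) \<otimes> g"
      using g by (simp add: m_assoc flip: m_assoc[of "inv g" g])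
    with x show "x \<in> (inv g <# H) #> g"
      by (auto simp: l_coset_def r_coset_def)
  qed
  then show ?thesis
    unfolding normal_core_def using one_closed by auto
qed

lemma conj_mult:
  assumes "x \<in> carrier G" "y \<in> carrier G" "g \<in> carrier G"
  shows "g \<otimes> (x \<otimes> y) \<otimes> inv g = (g \<otimes> x \<otimes> inv g) \<otimes> (g \<otimes> y \<otimes> inv g)"
  using assms by (simp add: m_assoc flip: m_assoc[of "inv g" g])

lemma conj_inv:
  assumes "x \<in> carrier G" "g \<in> carrier G"
  shows "g \<otimes> inv x \<otimes> inv g = inv (g \<otimes> x \<otimes> inv g)"
  using assms by (simp add: m_assoc inv_mult_group)

lemma conj_conj:
  assumes "x \<in> carrier G" "g \<in> carrier G" "k \<in> carrier G"
  shows "g \<otimes> (k \<otimes> x \<otimes> inv k) \<otimes> inv g = (g \<otimes> k) \<otimes> x \<otimes> inv (g \<otimes> k)"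
  using assms by (simp add: m_assoc inv_mult_group)

lemma normal_core_normal:
  assumes H: "subgroup H G"
  shows "normal_core G H \<lhd> G"
proof -
  note iff = normal_core_iff[OF subgroup.subset[OF H]]
  show ?thesis
  proof (rule normal_invI)
    show "subgroup (normal_core G H) G"
    proof (rule subgroupI)
      have "\<one> \<in> normal_core G H"
        using subgroup.one_closed[OF H] by (simp add: iff)
      then show "normal_core G H \<noteq> {}" by auto
    qed (auto simp: iff conj_mult conj_inv subgroup.m_closed[OF H] subgroup.m_inv_closed[OF H])
  qed (auto simp: iff conj_conj)
qed

lemma normal_core_subset:
  assumes "subgroup H G"
  shows "normal_core G H \<subseteq> H"
proof
  fix x assume "x \<in> normal_core G H"
  then have "x \<in> carrier G" "\<one> \<otimes> x \<otimes> inv \<one> \<in> H"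
    unfolding normal_core_iff[OF subgroup.subset[OF assms]] by blast+
  then show "x \<in> H" by simp
qed

lemma normal_core_mono:
  assumes "H \<subseteq> K"
  shows "normal_core G H \<subseteq> normal_core G K"
  unfolding normal_core_def l_coset_def r_coset_def using assms(1) by blast

text \<open>
  Because \<open>M\<close> normalises \<open>H\<close>, the conjugate of \<open>H\<close> by \<open>g\<close> depends only on the coset of \<open>g\<close> modulo
  \<open>M\<close>, so the core is an intersection of at most \<open>m\<close> conjugates. Conjugation preserves \<open>N\<close>, so
  each of them meets \<open>N\<close> in a subgroup of index at most \<open>n\<close>.
\<close>

lemma normal_core_index_le:
  assumes H: "subgroup H G" and M: "subgroup M G" and N: "N \<lhd> G"
    and norm: "\<And>l h. \<lbrakk>l \<in> M; h \<in> H\<rbrakk> \<Longrightarrow> l \<otimes> h \<otimes> inv l \<in> H"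
    and GM: "subgroup_index G (carrier G) M \<le> enat m"
    and NH: "subgroup_index G N (H \<inter> N) \<le> enat n" and "0 < n"
  shows "subgroup_index G N (normal_core G H \<inter> N) \<le> enat (n ^ m)"
proof -
  have Nsub: "subgroup N G" and Nc: "N \<subseteq> carrier G" and Hc: "H \<subseteq> carrier G"
    using normal_invE(1)[OF N] H by (auto dest: subgroup.subset)
  have HN: "subgroup (H \<inter> N) G"
    using H Nsub subgroups_Inter_pair by blast
  obtain f :: "'a \<Rightarrow> nat" where fm: "f ` carrier G \<subseteq> {..<m}"
    and fM: "\<And>x y. \<lbrakk>x \<in> carrier G; y \<in> carrier G; f x = f y\<rbrakk> \<Longrightarrow> x \<otimes> inv y \<in> M"
    using index_leE[OF GM M] by blast
  obtain c :: "'a \<Rightarrow> nat" where cn: "c ` N \<subseteq> {..<n}"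
    and cH: "\<And>x y. \<lbrakk>x \<in> N; y \<in> N; c x = c y\<rbrakk> \<Longrightarrow> x \<otimes> inv y \<in> H \<inter> N"
    using index_leE[OF NH HN Nc] by blast
  \<comment> \<open>\<open>t i\<close> represents the elements of colour \<open>i\<close>, and \<open>F x\<close> lists the colours modulo \<open>H\<close> of the
    conjugates of \<open>x\<close> by these representatives.\<close>
  define t where "t i = (SOME g. g \<in> carrier G \<and> f g = i)" for i
  have t: "t (f g) \<in> carrier G" "f (t (f g)) = f g" if "g \<in> carrier G" for g
    using someI[of "\<lambda>g'. g' \<in> carrier G \<and> f g' = f g" g] that by (auto simp: t_def)
  let ?I = "f ` carrier G"
  define F where "F x = (\<lambda>i\<in>?I. c (t i \<otimes> x \<otimes> inv (t i)))" for x
  have conjN: "g \<otimes> x \<otimes> inv g \<in> N" if "g \<in> carrier G" "x \<in> N" for g x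
    using normal_invE(2)[OF N] that by blast
  have "subgroup_index G N (normal_core G H \<inter> N) \<le> enat (card (?I \<rightarrow>\<^sub>E {..<n}))"
  proof (rule index_leI)
    show "subgroup (normal_core G H \<inter> N) G"
      using subgroups_Inter_pair normal_invE(1) normal_core_normal[OF H] Nsub by blast
    show "finite (?I \<rightarrow>\<^sub>E {..<n})"
      using fm finite_subset by (intro finite_PiE) auto
    show "F ` N \<subseteq> ?I \<rightarrow>\<^sub>E {..<n}"
    proof (rule image_subsetI)
      fix x assume x: "x \<in> N"
      have "c (t i \<otimes> x \<otimes> inv (t i)) \<in> {..<n}" if "i \<in> ?I" for i
      proof -
        have "t i \<in> carrier G"
          using that t by blast
        then show ?thesis
          using conjN[OF _ x] cn by blast
      qed
      then show "F x \<in> ?I \<rightarrow>\<^sub>E {..<n}"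
        unfolding F_def by (rule restrict_PiE_iff[THEN iffD2, rule_format])
    qed
  next
    fix x y assume xy: "x \<in> N" "y \<in> N" and eq: "F x = F y"
    have xyc: "x \<in> carrier G" "y \<in> carrier G"
      using xy Nc by auto
    have "g \<otimes> (x \<otimes> inv y) \<otimes> inv g \<in> H" if g: "g \<in> carrier G" for g
    proof -
      let ?t = "t (f g)" let ?z = "?t \<otimes> (x \<otimes> inv y) \<otimes> inv ?t" let ?l = "g \<otimes> inv ?t"
      \<comment> \<open>\<open>g = ?l ?t\<close> with \<open>?l \<in> M\<close>: first conjugate by the representative, then by an element
        that normalises \<open>H\<close>.\<close>
      have tc: "?t \<in> carrier G" and l: "?l \<in> M"
        using t fM g by auto
      have "c (?t \<otimes> x \<otimes> inv ?t) = c (?t \<otimes> y \<otimes> inv ?t)"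
        using fun_cong[OF eq, of "f g"] g by (simp add: F_def)
      then have "?z \<in> H"
        using cH[of "?t \<otimes> x \<otimes> inv ?t" "?t \<otimes> y \<otimes> inv ?t"] conjN tc xy xyc
        by (simp add: conj_mult conj_inv)
      then have "?l \<otimes> ?z \<otimes> inv ?l \<in> H"
        using norm l by blast
      moreover have "?l \<otimes> ?z \<otimes> inv ?l = g \<otimes> (x \<otimes> inv y) \<otimes> inv g"
        using g tc xyc by (subst conj_conj) (simp_all add: m_assoc)
      ultimately show ?thesis by simp
    qed
    then show "x \<otimes> inv y \<in> normal_core G H \<inter> N"
      using xy xyc Nsub by (simp add: normal_core_iff[OF Hc] subgroup.m_closed subgroup.m_inv_closed)
  qed (rule Nc)
  also have "card (?I \<rightarrow>\<^sub>E {..<n}) = n ^ card ?I"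
    using fm finite_subset by (subst card_PiE) auto
  also have "n ^ card ?I \<le> n ^ m"
    using \<open>0 < n\<close> fm card_mono[OF _ fm] by (intro power_increasing) auto
  finally show ?thesis by simp
qed

section \<open>Finite-by-CF groups are CN-groups\<close>

text \<open>
  The core \<open>N\<close> of \<open>HF\<close> is the witness. An element of \<open>HF\<close> is coloured by its class modulo \<open>N\<close>
  together with a factor in \<open>F\<close>; two elements \<open>h k\<close> and \<open>h' k\<close> with the same factor differ by an
  element of \<open>H\<close>.
\<close>

lemma delta_le_if_core_index_le:
  assumes H: "subgroup H G" and F: "F \<lhd> G" "finite F"
    and le: "subgroup_index G (H <#> F) (normal_core G (H <#> F)) \<le> enat n"
  shows "delta G H \<le> enat (n * card F)"
proof -
  let ?E = "H <#> F" and ?N = "normal_core G (H <#> F)"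
  have E: "subgroup ?E G"
    using mult_norm_subgroup[OF F(1) H] commut_normal[OF H F(1)] by simp
  have Ec: "?E \<subseteq> carrier G" and Hc: "H \<subseteq> carrier G" and Fc: "F \<subseteq> carrier G"
    using E H normal_invE(1)[OF F(1)] by (auto dest: subgroup.subset)
  have N: "?N \<lhd> G" and Nsub: "subgroup ?N G" and NE: "?N \<subseteq> ?E"
    using normal_core_normal[OF E] normal_core_subset[OF E] normal_invE(1) by auto
  have HE: "H \<subseteq> ?E"
  proof
    fix h assume h: "h \<in> H"
    then have "h \<otimes> \<one> \<in> ?E"
      using subgroup.one_closed[OF normal_invE(1)[OF F(1)]] unfolding set_mult_def by blast
    then show "h \<in> ?E" using h Hc by (simp add: subset_iff)
  qed
  have HNE: "H <#> ?N \<subseteq> ?E"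
  proof
    fix x assume "x \<in> H <#> ?N"
    then obtain h u where "h \<in> H" "u \<in> ?N" "x = h \<otimes> u"
      unfolding set_mult_def[of G H ?N] by blast
    then show "x \<in> ?E"
      using subgroup.m_closed[OF E] HE NE by (simp add: subset_iff)
  qed
  obtain f :: "'a \<Rightarrow> nat" where f: "f ` ?E \<subseteq> {..<n}"
    and fN: "\<And>x y. \<lbrakk>x \<in> ?E; y \<in> ?E; f x = f y\<rbrakk> \<Longrightarrow> x \<otimes> inv y \<in> ?N"
    using index_leE[OF le Nsub Ec] by blast
  have "\<forall>x\<in>?E. \<exists>k. k \<in> F \<and> (\<exists>h\<in>H. x = h \<otimes> k)"
    unfolding set_mult_def by blast
  from bchoice[OF this] obtain k where k: "\<forall>x\<in>?E. k x \<in> F \<and> (\<exists>h\<in>H. x = h \<otimes> k x)"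
    by blast
  have "subgroup_index G (H <#> ?N) (H \<inter> ?N) \<le> enat (card ({..<n} \<times> F))"
  proof (rule index_leI)
    show "subgroup (H \<inter> ?N) G"
      using H Nsub subgroups_Inter_pair by blast
    show "(\<lambda>x. (f x, k x)) ` (H <#> ?N) \<subseteq> {..<n} \<times> F"
      using f k HNE by blast
  next
    fix x y assume "x \<in> H <#> ?N" "y \<in> H <#> ?N" and eq: "(f x, k x) = (f y, k y)"
    then have xy: "x \<in> ?E" "y \<in> ?E"
      using HNE by auto
    obtain h where h: "h \<in> H" "x = h \<otimes> k x"
      using k xy(1) by blast
    obtain h' where h': "h' \<in> H" "y = h' \<otimes> k y"
      using k xy(2) by blast
    have "k x \<in> carrier G" "h \<in> carrier G" "h' \<in> carrier G"
      using k xy(1) Fc Hc h(1) h'(1) by auto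
    then have "(h \<otimes> k x) \<otimes> inv (h' \<otimes> k x) = h \<otimes> inv h'"
      by (simp add: inv_mult_group m_assoc flip: m_assoc[of "k x" "inv (k x)"])
    moreover have "k y = k x" and fxy: "f x = f y"
      using eq by auto
    ultimately have "x \<otimes> inv y = h \<otimes> inv h'"
      using h(2) h'(2) by metis
    moreover have "h \<otimes> inv h' \<in> H"
      using h(1) h'(1) by (intro subgroup.m_closed[OF H] subgroup.m_inv_closed[OF H])
    ultimately show "x \<otimes> inv y \<in> H \<inter> ?N"
      using fN[OF xy fxy] by simp
  qed (use F HNE Ec in auto)
  then have "subgroup_index G (H <#> ?N) (H \<inter> ?N) \<le> enat (n * card F)"
    unfolding card_cartesian_product card_lessThan .
  with N show ?thesis
    unfolding delta_le_iff[OF is_group] by blast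
qed

section \<open>Finite-by-abelian-by-finite groups\<close>

text \<open>
  The bound comes from the chain \<open>H \<ge> B \<ge> B \<inter> N \<ge> P\<close>, where \<open>B = H \<inter> L\<close> and \<open>P\<close> is the intersection of
  \<open>N\<close> with the core of \<open>B\<close>; its steps have index at most \<open>m\<close>, \<open>n\<close> and \<open>n ^ m\<close>. That \<open>H\<close> contains
  the derived subgroup of \<open>L\<close> is what makes \<open>B\<close> invariant under \<open>L\<close>.
\<close>

lemma core_index_le_if_delta_le:
  assumes L: "L \<lhd> G" and GL: "subgroup_index G (carrier G) L \<le> enat m"
    and H: "subgroup H G" and der: "derived G L \<subseteq> H"
    and delta: "delta G (H \<inter> L) \<le> enat n" and "0 < n"
  shows "subgroup_index G H (normal_core G H) \<le> enat (m * (n * n ^ m))"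
proof -
  let ?B = "H \<inter> L"
  have Lsub: "subgroup L G" using L normal_invE(1) by blast
  have Bsub: "subgroup ?B G" using H Lsub subgroups_Inter_pair by blast
  have Bc: "?B \<subseteq> carrier G" and Hc: "H \<subseteq> carrier G"
    using H by (auto dest: subgroup.subset)
  obtain N where N: "N \<lhd> G" and le: "subgroup_index G (?B <#> N) (?B \<inter> N) \<le> enat n"
    using delta by (auto simp: delta_le_iff[OF is_group])
  have Nsub: "subgroup N G" using N normal_invE(1) by blast
  have BN: "subgroup (?B \<inter> N) G" using Bsub Nsub subgroups_Inter_pair by blast
  have prod: "subgroup (?B <#> N) G"
    using mult_norm_subgroup[OF N Bsub] commut_normal[OF Bsub N] by simp
  have "x \<otimes> \<one> \<in> ?B <#> N" if "x \<in> ?B" for x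
    using that subgroup.one_closed[OF Nsub] unfolding set_mult_def by blast
  then have B_prod: "?B \<subseteq> ?B <#> N"
    using Bc by (metis r_one subset_iff)
  have "\<one> \<otimes> x \<in> ?B <#> N" if "x \<in> N" for x
    using that subgroup.one_closed[OF Bsub] unfolding set_mult_def by blast
  then have N_prod: "N \<subseteq> ?B <#> N"
    using subgroup.subset[OF Nsub] by (metis l_one subset_iff)
  have norm: "l \<otimes> h \<otimes> inv l \<in> ?B" if lh: "l \<in> L" "h \<in> ?B" for l h
  proof -
    have c: "l \<in> carrier G" "h \<in> carrier G"
      using lh Bc subgroup.subset[OF Lsub] by auto
    \<comment> \<open>The conjugate of \<open>h\<close> by \<open>l\<close> is \<open>[l, h] h\<close>, with the commutator in \<open>H\<close>.\<close>
    have "l \<otimes> h \<otimes> inv l \<otimes> inv h \<in> derived G L"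
      unfolding derived_def using lh by (intro generate.incl) auto
    then have "l \<otimes> h \<otimes> inv l \<otimes> inv h \<otimes> h \<in> H"
      using der lh subgroup.m_closed[OF H] by blast
    moreover have "l \<otimes> h \<otimes> inv l \<otimes> inv h \<otimes> h = l \<otimes> h \<otimes> inv l"
      using c by (simp add: m_assoc)
    moreover have "l \<otimes> h \<otimes> inv l \<in> L"
      using normal_invE(2)[OF L] c lh by auto
    ultimately show ?thesis by simp
  qed
  let ?P = "normal_core G ?B \<inter> N"
  have Csub: "subgroup (normal_core G ?B) G" "subgroup (normal_core G H) G"
    using normal_core_normal[OF Bsub] normal_core_normal[OF H] normal_invE(1) by auto
  have Psub: "subgroup ?P G"
    using Csub Nsub subgroups_Inter_pair by blast
  have "subgroup_index G N (?B \<inter> N) \<le> enat n"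
    by (rule index_mono[OF le BN subgroup.subset[OF prod] N_prod BN _ Nsub]) auto
  then have "subgroup_index G N ?P \<le> enat (n ^ m)"
    by (intro normal_core_index_le[OF Bsub Lsub N norm GL _ \<open>0 < n\<close>])
  then have "subgroup_index G (?B \<inter> N) ?P \<le> enat (n ^ m)"
    by (rule index_mono[OF _ Psub subgroup.subset[OF Nsub] _ Psub _ BN]) auto
  moreover have "subgroup_index G ?B (?B \<inter> N) \<le> enat n"
    by (rule index_mono[OF le BN subgroup.subset[OF prod] B_prod BN _ Bsub]) auto
  ultimately have "subgroup_index G ?B ?P \<le> enat (n * n ^ m)"
    using index_trans Bsub BN Psub by blast
  moreover have "subgroup_index G H ?B \<le> enat m"
    by (rule index_mono[OF GL Lsub order_refl Hc Bsub _ H]) auto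
  ultimately have "subgroup_index G H ?P \<le> enat (m * (n * n ^ m))"
    using index_trans H Bsub Psub by blast
  then show ?thesis
    by (rule index_mono[OF _ Psub Hc order_refl Csub(2) _ H])
      (use normal_core_mono[of ?B H] Hc in auto)
qed

text \<open>
  The core of a finite-by-abelian subgroup \<open>K\<close> of finite index has finite index too: this is
  \<open>normal_core_index_le\<close> with \<open>M = H = K\<close> and the whole group in place of \<open>N\<close>.
\<close>

lemma finite_by_abelian_by_finite_normal:
  assumes "finite_by_abelian_by_finite G"
  obtains L m where "L \<lhd> G" "finite (derived G L)" "subgroup_index G (carrier G) L \<le> enat m"
proof -
  obtain K where K: "subgroup K G" and fin: "finite (derived (G\<lparr>carrier := K\<rparr>) K)"
    and "subgroup_index G (carrier G) K \<noteq> \<infinity>"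
    using assms unfolding finite_by_abelian_by_finite_def finite_by_abelian_def by auto
  then obtain m where le: "subgroup_index G (carrier G) K \<le> enat m"
    unfolding not_infinity_iff_le by blast
  let ?L = "normal_core G K"
  have Kc: "K \<subseteq> carrier G"
    by (rule subgroup.subset[OF K])
  have LK: "?L \<subseteq> K"
    by (rule normal_core_subset[OF K])
  have "finite (derived G K)"
    using fin derived_consistent[OF order_refl K] by simp
  then have fin_L: "finite (derived G ?L)"
    using finite_subset[OF mono_derived[OF LK]] by blast
  \<comment> \<open>\<open>Suc m\<close> serves as a positive number of colours.\<close>
  have "subgroup_index G (carrier G) (K \<inter> carrier G) \<le> enat (Suc m)"
    using le Kc by (simp add: Int_absorb2 subgroup_index_le_iff)
  moreover have "l \<otimes> h \<otimes> inv l \<in> K" if "l \<in> K" "h \<in> K" for l h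
    using that by (simp add: subgroup.m_closed[OF K] subgroup.m_inv_closed[OF K])
  ultimately have "subgroup_index G (carrier G) (?L \<inter> carrier G) \<le> enat (Suc m ^ m)"
    using normal_core_index_le[OF K K normal_self _ le] by blast
  moreover have "?L \<inter> carrier G = ?L"
    using LK Kc by blast
  ultimately have GL: "subgroup_index G (carrier G) ?L \<le> enat (Suc m ^ m)"
    by simp
  show thesis
    by (rule that[OF normal_core_normal[OF K] fin_L GL])
qed

end

section \<open>Passage to a quotient\<close>

lemma (in group_hom) vimage_subgroup:
  assumes "subgroup S H"
  shows "subgroup {x \<in> carrier G. h x \<in> S} G"
proof (rule G.subgroupI)
  show "{x \<in> carrier G. h x \<in> S} \<noteq> {}"
    using subgroup.one_closed[OF assms] G.one_closed hom_one by auto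
qed (auto simp: subgroup.m_closed[OF assms] subgroup.m_inv_closed[OF assms])

text \<open>
  For a surjective homomorphism the core of a preimage is the preimage of the core, so colourings
  can be pulled back along \<open>h\<close> and pushed forward along a choice of preimages.
\<close>

lemma (in group_hom) core_index_vimage_le_iff:
  assumes surj: "h ` carrier G = carrier H" and S: "subgroup S H"
  shows "subgroup_index G {x \<in> carrier G. h x \<in> S} (normal_core G {x \<in> carrier G. h x \<in> S}) \<le> enat n
     \<longleftrightarrow> subgroup_index H S (normal_core H S) \<le> enat n"
proof -
  let ?P = "{x \<in> carrier G. h x \<in> S}"
  note P = vimage_subgroup[OF S]
  have Pc: "?P \<subseteq> carrier G" and Sc: "S \<subseteq> carrier H"
    using S by (auto dest: subgroup.subset)
  have core: "x \<in> normal_core G ?P \<longleftrightarrow> h x \<in> normal_core H S" if "x \<in> carrier G" for x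
    unfolding G.normal_core_iff[OF Pc] H.normal_core_iff[OF Sc] surj[symmetric]
    using that by auto
  have sub: "subgroup (normal_core G ?P) G" "subgroup (normal_core H S) H"
    using G.normal_core_normal[OF P] H.normal_core_normal[OF S] G.normal_invE(1) H.normal_invE(1)
    by auto
  show ?thesis
  proof
    assume "subgroup_index G ?P (normal_core G ?P) \<le> enat n"
    then obtain f :: "'a \<Rightarrow> nat" where f: "f ` ?P \<subseteq> {..<n}"
      and *: "\<And>x y. \<lbrakk>x \<in> ?P; y \<in> ?P; f x = f y\<rbrakk> \<Longrightarrow> x \<otimes> inv y \<in> normal_core G ?P"
      using G.index_leE[OF _ sub(1) Pc] by blast
    have "\<exists>x. x \<in> ?P \<and> h x = u" if "u \<in> S" for u
    proof -
      have "u \<in> h ` carrier G"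
        using that Sc surj by blast
      then show ?thesis
        using that by blast
    qed
    then obtain r where r: "\<And>u. u \<in> S \<Longrightarrow> r u \<in> ?P \<and> h (r u) = u"
      by metis
    have "subgroup_index H S (normal_core H S) \<le> enat (card {..<n})"
    proof (rule H.index_leI)
      show "(\<lambda>u. f (r u)) ` S \<subseteq> {..<n}"
        using f r by blast
    next
      fix u v assume uv: "u \<in> S" "v \<in> S" "f (r u) = f (r v)"
      then have "h (r u \<otimes> inv (r v)) \<in> normal_core H S"
        using *[of "r u" "r v"] r[of u] r[of v] core[of "r u \<otimes> inv (r v)"] by auto
      then show "u \<otimes>\<^bsub>H\<^esub> inv\<^bsub>H\<^esub> v \<in> normal_core H S"
        using r[of u] r[of v] uv by simp
    qed (use sub Sc in auto)
    then show "subgroup_index H S (normal_core H S) \<le> enat n" by simp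
  next
    assume "subgroup_index H S (normal_core H S) \<le> enat n"
    then obtain f :: "'c \<Rightarrow> nat" where f: "f ` S \<subseteq> {..<n}"
      and *: "\<And>u v. \<lbrakk>u \<in> S; v \<in> S; f u = f v\<rbrakk> \<Longrightarrow> u \<otimes>\<^bsub>H\<^esub> inv\<^bsub>H\<^esub> v \<in> normal_core H S"
      using H.index_leE[OF _ sub(2) Sc] by blast
    have "subgroup_index G ?P (normal_core G ?P) \<le> enat (card {..<n})"
    proof (rule G.index_leI)
      show "(\<lambda>x. f (h x)) ` ?P \<subseteq> {..<n}"
        using f by auto
    next
      fix x y assume "x \<in> ?P" "y \<in> ?P" "f (h x) = f (h y)"
      then show "x \<otimes> inv y \<in> normal_core G ?P"
        using * core[of "x \<otimes> inv y"] by simp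
    qed (use sub in auto)
    then show "subgroup_index G ?P (normal_core G ?P) \<le> enat n" by simp
  qed
qed

context group
begin

lemma Mod_group_hom:
  assumes "F \<lhd> G"
  shows "group_hom G (G Mod F) (\<lambda>x. F #> x)"
  using assms is_group normal.factorgroup_is_group normal.r_coset_hom_Mod
  by (auto simp: group_hom_def group_hom_axioms_def)

lemma rcos_eq_iff:
  assumes "subgroup F G" "x \<in> carrier G" "y \<in> carrier G"
  shows "F #> x = F #> y \<longleftrightarrow> x \<in> F #> y"
  using assms rcos_self repr_independence by metis

text \<open>
  The preimage of the image of \<open>H\<close> modulo \<open>F\<close> is \<open>HF\<close>, which carries the two estimates over to
  the quotient.
\<close>

lemma delta_le_if_Mod_core_index_le:
  assumes H: "subgroup H G" and F: "F \<lhd> G" "finite F"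
    and le: "subgroup_index (G Mod F) ((\<lambda>x. F #> x) ` H)
      (normal_core (G Mod F) ((\<lambda>x. F #> x) ` H)) \<le> enat n"
  shows "delta G H \<le> enat (n * card F)"
proof -
  interpret Q: group_hom G "G Mod F" "\<lambda>x. F #> x"
    by (rule Mod_group_hom[OF F(1)])
  let ?S = "(\<lambda>x. F #> x) ` H"
  have Fsub: "subgroup F G" using F normal_invE(1) by blast
  have Hc: "H \<subseteq> carrier G" and Fc: "F \<subseteq> carrier G"
    using H Fsub by (auto dest: subgroup.subset)
  have "{x \<in> carrier G. F #> x \<in> ?S} = {x \<in> carrier G. \<exists>h\<in>H. x \<in> F #> h}"
    using Hc rcos_eq_iff[OF Fsub] by blast
  also have "\<dots> = F <#> H"
    using Hc Fc by (auto simp: r_coset_def set_mult_def)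
  also have "\<dots> = H <#> F"
    by (rule commut_normal[OF H F(1), symmetric])
  finally have "subgroup_index G (H <#> F) (normal_core G (H <#> F)) \<le> enat n"
    using le Q.core_index_vimage_le_iff[OF carrier_FactGroup[symmetric]
        Q.subgroup_img_is_subgroup[OF H], of n] by simp
  then show ?thesis
    by (rule delta_le_if_core_index_le[OF H F])
qed

lemma Mod_core_index_le_if_delta_le:
  fixes L
  defines "F \<equiv> derived G L"
  assumes L: "L \<lhd> G" and GL: "subgroup_index G (carrier G) L \<le> enat m"
    and S: "subgroup S (G Mod F)"
    and delta: "delta G ({x \<in> carrier G. F #> x \<in> S} \<inter> L) \<le> enat n" and "0 < n"
  shows "subgroup_index (G Mod F) S (normal_core (G Mod F) S) \<le> enat (m * (n * n ^ m))"
proof -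
  have F: "F \<lhd> G" unfolding F_def by (rule derived_is_normal[OF L])
  interpret Q: group_hom G "G Mod F" "\<lambda>x. F #> x"
    by (rule Mod_group_hom[OF F])
  let ?H = "{x \<in> carrier G. F #> x \<in> S}"
  have Fsub: "subgroup F G" using F normal_invE(1) by blast
  have "F \<subseteq> ?H"
    using coset_join2[OF _ Fsub] subgroup.one_closed[OF S] subgroup.subset[OF Fsub] by auto
  then have "subgroup_index G ?H (normal_core G ?H) \<le> enat (m * (n * n ^ m))"
    using delta \<open>0 < n\<close> unfolding F_def
    by (intro core_index_le_if_delta_le[OF L GL Q.vimage_subgroup[OF S, unfolded F_def]])
  then show ?thesis
    using Q.core_index_vimage_le_iff[OF carrier_FactGroup[symmetric] S] by simp
qed

end

theorem theoremB:
  fixes G :: "('a, 'b) monoid_scheme"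
  assumes "group G"
    and "finite_by_abelian_by_finite G"
  shows "(CN_group G \<longleftrightarrow> (\<exists>F. F \<lhd> G \<and> finite F \<and> CF_group (G Mod F))) \<and>
         (BCN_group G \<longleftrightarrow> (\<exists>F. F \<lhd> G \<and> finite F \<and> BCF_group (G Mod F)))"
proof -
  interpret group G by (rule assms(1))
  obtain L m where L: "L \<lhd> G" and fin: "finite (derived G L)"
    and GL: "subgroup_index G (carrier G) L \<le> enat m"
    using finite_by_abelian_by_finite_normal[OF assms(2)] .
  let ?F = "derived G L"
  let ?pre = "\<lambda>S. {x \<in> carrier G. ?F #>\<^bsub>G\<^esub> x \<in> S} \<inter> L"
  have F: "?F \<lhd> G" by (rule derived_is_normal[OF L])
  have pre: "subgroup (?pre S) G" if "subgroup S (G Mod ?F)" for S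
    using group_hom.vimage_subgroup[OF Mod_group_hom[OF F] that] normal_invE(1)[OF L]
      subgroups_Inter_pair by blast
  \<comment> \<open>\<open>Suc n\<close> weakens the bound \<open>n\<close> to a positive one.\<close>
  have up: "subgroup_index (G Mod ?F) S (normal_core (G Mod ?F) S) \<le> enat (m * (Suc n * Suc n ^ m))"
    if "subgroup S (G Mod ?F)" "delta G (?pre S) \<le> enat n" for S n
    using that by (intro Mod_core_index_le_if_delta_le[OF L GL]) (auto elim: order_trans)
  have img: "subgroup ((\<lambda>x. F #>\<^bsub>G\<^esub> x) ` H) (G Mod F)" if "F \<lhd> G" "subgroup H G" for F H
    using group_hom.subgroup_img_is_subgroup[OF Mod_group_hom] that by blast
  show ?thesis
  proof (intro conjI iffI)
    assume "CN_group G"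
    then have "CF_group (G Mod ?F)"
      unfolding CN_group_def CF_group_def not_infinity_iff_le using pre up by meson
    with F fin show "\<exists>F. F \<lhd> G \<and> finite F \<and> CF_group (G Mod F)" by blast
  next
    assume "BCN_group G"
    then have "BCF_group (G Mod ?F)"
      unfolding BCN_group_def BCF_group_def using pre up by meson
    with F fin show "\<exists>F. F \<lhd> G \<and> finite F \<and> BCF_group (G Mod F)" by blast
  next
    assume "\<exists>F. F \<lhd> G \<and> finite F \<and> CF_group (G Mod F)"
    then show "CN_group G"
      unfolding CN_group_def CF_group_def not_infinity_iff_le
      using delta_le_if_Mod_core_index_le img by meson
  next
    assume "\<exists>F. F \<lhd> G \<and> finite F \<and> BCF_group (G Mod F)"
    then show "BCN_group G"
      unfolding BCN_group_def BCF_group_def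
      using delta_le_if_Mod_core_index_le img by meson
  qed
qed

end
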